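(* For every prime $p \ge 5$, the graph $G_p = \mathrm{ICG}_{12p}(\{2,p\})$ is a uniquely $3$-colorable circulant graph with clique number $\omega(G_p) = 2$. Consequently, there exists an infinite family of uniquely colorable circulant graphs $G$ with $\chi(G) \neq \omega(G)$, so the question "does every uniquely colorable circulant graph $G$ satisfy $\chi(G)=\omega(G)$?" has a negative answer.
   Context: For a positive integer $n$ and a set $D$ of positive divisors of $n$, all strictly less than $n$, the integral circulant graph $\mathrm{ICG}_n(D)$ is the simple undirected graph with vertex set $\mathbb{Z}_n=\{0,1,\dots,n-1\}$ in which two distinct vertices $a,b$ are adjacent if and only if $\gcd(a-b,n)\in D$. A circulant graph is a Cayley graph on a finite cyclic group, i.e. a graph on $\mathbb{Z}_n$ where $i,j$ are adjacent iff $i-j \bmod n\in S$, for some $S\subseteq \mathbb{Z}_n\setminus\{0\}$ with $S=-S$. $\chi(G)$ is the chromatic number and $\omega(G)$ the clique number. A proper $k$-coloring of $G$ is regarded as a partition of $V(G)$ into $k$ independent sets (color classes). A graph $G$ is uniquely colorable (uniquely $k$-colorable with $k=\chi(G)$) if all proper colorings of $G$ with $\chi(G)$ colors induce the same partition of $V(G)$ into color classes. *)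

theory Defs
  imports
    "HOL-Computational_Algebra.Primes"
    "HOL-Library.Disjoint_Sets"
    "Graph_Theory.Graph_Theory"
begin

text \<open>
  A finite simple undirected graph is a \<^typ>\<open>'a pair_pre_digraph\<close> satisfying the locale
  \<^locale>\<open>pair_graph\<close>: an edge \<open>uv\<close> is the pair of arcs \<open>(u, v)\<close> and \<open>(v, u)\<close>.
  The group of integers modulo \<open>n\<close> is represented by \<open>{0..<int n}\<close>.
\<close>

text \<open>Elements of \<open>D\<close> that are not proper divisors of \<open>n\<close> contribute no edges.\<close>

definition ICG :: "nat \<Rightarrow> nat set \<Rightarrow> int pair_pre_digraph" where
  "ICG n D = \<lparr> pverts = {0..<int n},
     parcs = {(a, b). a \<in> {0..<int n} \<and> b \<in> {0..<int n} \<and> a \<noteq> b \<and>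
                      nat (gcd (a - b) (int n)) \<in> D} \<rparr>"

definition cayley_graph_mod :: "nat \<Rightarrow> int set \<Rightarrow> int pair_pre_digraph" where
  "cayley_graph_mod n S = \<lparr> pverts = {0..<int n},
     parcs = {(i, j). i \<in> {0..<int n} \<and> j \<in> {0..<int n} \<and> (i - j) mod int n \<in> S} \<rparr>"

definition circulant :: "int pair_pre_digraph \<Rightarrow> bool" where
  "circulant G \<longleftrightarrow> (\<exists>n S. n \<ge> 1 \<and> S \<subseteq> {0..<int n} - {0} \<and>
     S = (\<lambda>s. (- s) mod int n) ` S \<and> G = cayley_graph_mod n S)"

definition independent_set :: "'a pair_pre_digraph \<Rightarrow> 'a set \<Rightarrow> bool" where
  "independent_set G A \<longleftrightarrow> A \<subseteq> pverts G \<and> (\<forall>u\<in>A. \<forall>v\<in>A. (u, v) \<notin> parcs G)"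

definition clique :: "'a pair_pre_digraph \<Rightarrow> 'a set \<Rightarrow> bool" where
  "clique G A \<longleftrightarrow> A \<subseteq> pverts G \<and> (\<forall>u\<in>A. \<forall>v\<in>A. u \<noteq> v \<longrightarrow> (u, v) \<in> parcs G)"

definition clique_number :: "'a pair_pre_digraph \<Rightarrow> nat" where
  "clique_number G = Max {card A | A. clique G A}"

text \<open>A proper \<open>k\<close>-coloring is identified with its partition into (nonempty) color classes.\<close>

definition proper_coloring :: "'a pair_pre_digraph \<Rightarrow> nat \<Rightarrow> 'a set set \<Rightarrow> bool" where
  "proper_coloring G k P \<longleftrightarrow>
     partition_on (pverts G) P \<and> finite P \<and> card P = k \<and> (\<forall>A\<in>P. independent_set G A)"

definition chromatic_number :: "'a pair_pre_digraph \<Rightarrow> nat" where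
  "chromatic_number G = (LEAST k. \<exists>P. proper_coloring G k P)"

definition uniquely_colorable :: "'a pair_pre_digraph \<Rightarrow> bool" where
  "uniquely_colorable G \<longleftrightarrow> (\<exists>!P. proper_coloring G (chromatic_number G) P)"

definition uniquely_k_colorable :: "nat \<Rightarrow> 'a pair_pre_digraph \<Rightarrow> bool" where
  "uniquely_k_colorable k G \<longleftrightarrow> chromatic_number G = k \<and> uniquely_colorable G"

lemma pair_graph_ICG: "pair_graph (ICG n D)"
proof -
  have "parcs (ICG n D) \<subseteq> {0..<int n} \<times> {0..<int n}"
    by (auto simp: ICG_def)
  then have "finite (parcs (ICG n D))"
    by (rule finite_subset) simp
  moreover have "gcd (b - a) (int n) = gcd (a - b) (int n)" for a b
    using gcd_neg1_int[of "a - b" "int n"] by simp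
  ultimately show ?thesis
    by unfold_locales (auto simp: ICG_def Digraph.symmetric_def sym_def)
qed

lemma pair_graph_circulant:
  assumes "circulant G"
  shows "pair_graph G"
proof -
  obtain n S where S: "S \<subseteq> {0..<int n} - {0}" "S = (\<lambda>s. (- s) mod int n) ` S"
    and G: "G = cayley_graph_mod n S"
    using assms unfolding circulant_def by blast
  have neg: "(j - i) mod int n \<in> S" if "(i - j) mod int n \<in> S" for i j
  proof -
    have "(- ((i - j) mod int n)) mod int n \<in> S"
      using S(2) that by blast
    then show ?thesis
      by (simp add: mod_minus_eq)
  qed
  have "parcs G \<subseteq> {0..<int n} \<times> {0..<int n}"
    by (auto simp: G cayley_graph_mod_def)
  then have "finite (parcs G)"
    by (rule finite_subset) simp
  then show ?thesis
    using S(1) neg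
    by unfold_locales (auto simp: G cayley_graph_mod_def Digraph.symmetric_def sym_def)
qed

end

theory Submission
  imports Defs
begin

text \<open>
  By the Chinese remainder theorem \<open>ICG (12 * p) {2, p}\<close> is the tensor product of \<open>K\<^sub>3\<close>, carried by
  the residues modulo 3, with a graph \<open>H\<close> on \<open>\<int>\<^sub>4 \<times> \<int>\<^sub>p\<close>. The graph \<open>H\<close> is connected and not
  3-colorable, so by an argument of Greenwell and Lovasz every 3-coloring of the product factors
  through \<open>K\<^sub>3\<close>: the color classes are the residue classes modulo 3. The clique number is 2 because
  three differences of a triangle sum to 0, which is impossible modulo 4 or modulo \<open>p\<close>.
\<close>

section \<open>Colorings of tensor products with a complete graph\<close>

text \<open>An injective \<open>\<phi> v\<close> uses every color of \<open>C\<close>, because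
  \<open>card C \<le> card I\<close>. For a neighbor \<open>w\<close>, the color
  \<open>\<phi> w i\<close> therefore equals some \<open>\<phi> v j\<close>, and properness leaves
  only \<open>j = i\<close>. Connectedness carries this agreement to all vertices.\<close>

lemma tensor_complete_coloring:
  fixes \<phi> :: "'v \<Rightarrow> 'i \<Rightarrow> 'c"
  assumes fin: "finite C" "finite I" and card: "card C \<le> card I"
    and colors: "\<And>v i. i \<in> I \<Longrightarrow> \<phi> v i \<in> C"
    and proper: "\<And>v w i j. \<lbrakk>E v w; i \<in> I; j \<in> I; i \<noteq> j\<rbrakk> \<Longrightarrow> \<phi> v i \<noteq> \<phi> w j"
    and conn: "\<And>v w. E\<^sup>*\<^sup>* v w"
    and not_colorable: "\<And>g. (\<And>v. g v \<in> C) \<Longrightarrow> \<exists>v w. E v w \<and> g v = g w"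
  obtains \<psi> where "inj_on \<psi> I" and "\<And>v i. i \<in> I \<Longrightarrow> \<phi> v i = \<psi> i"
proof -
  have "\<exists>v. inj_on (\<phi> v) I"
  proof (rule ccontr)
    \<comment> \<open>Otherwise a color that \<open>\<phi> v\<close> takes twice, chosen for each \<open>v\<close>, would color \<open>E\<close> properly.\<close>
    assume "\<nexists>v. inj_on (\<phi> v) I"
    then have "\<forall>v. \<exists>c. \<exists>i\<in>I. \<exists>j\<in>I. i \<noteq> j \<and> \<phi> v i = c \<and> \<phi> v j = c"
      unfolding inj_on_def by metis
    then obtain g where g: "\<And>v. \<exists>i\<in>I. \<exists>j\<in>I. i \<noteq> j \<and> \<phi> v i = g v \<and> \<phi> v j = g v"
      by metis
    have "g v \<in> C" for v
      using g[of v] colors by metis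
    then obtain v w where vw: "E v w" "g v = g w"
      using not_colorable by blast
    obtain i where "i \<in> I" "\<phi> v i = g v"
      using g by blast
    moreover obtain j where "j \<in> I" "\<phi> w j = g w" "j \<noteq> i"
      using g[of w] by metis
    ultimately show False
      using proper[OF vw(1), of i j] vw(2) by simp
  qed
  then obtain v where inj: "inj_on (\<phi> v) I"
    by blast
  have "\<phi> v ` I = C"
    using fin card colors card_image[OF inj] by (intro card_seteq) auto
  have "\<phi> w i = \<phi> v i" if "i \<in> I" for w i
    using conn[of v w] that
  proof (induction arbitrary: i rule: rtranclp_induct)
    case (step u w)
    have "\<phi> w i \<in> \<phi> v ` I"
      using colors[OF step.prems] \<open>\<phi> v ` I = C\<close> by simp
    then obtain j where "j \<in> I" "\<phi> w i = \<phi> v j"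
      by blast
    then show ?case
      using proper[OF step.hyps(2), of j i] step.IH[of j] step.prems by metis
  qed simp
  with inj show thesis
    by (rule that)
qed

section \<open>The factor graph modulo 4 and \<open>p\<close>\<close>

lemma no_four_distinct:
  assumes "finite C" "card C \<le> 3" "a \<in> C" "b \<in> C" "c \<in> C" "d \<in> C"
    and "a \<noteq> b" "a \<noteq> c" "a \<noteq> d" "b \<noteq> c" "b \<noteq> d" "c \<noteq> d"
  shows False
proof -
  have "card {a, b, c, d} \<le> card C"
    using assms by (intro card_mono) auto
  with assms show False
    by simp
qed

text \<open>This concerns the crown graph, K_{4,4} minus a perfect matching. With \<open>e\<close>
  and \<open>f\<close> the other two indices, monochromatic pairs at both \<open>c\<close> and
  \<open>d\<close> would make \<open>x c\<close>, \<open>x d\<close>, \<open>x e\<close> and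
  \<open>y f\<close> four different colors.\<close>

lemma crown_at_most_one_monochromatic:
  fixes x y :: "int \<Rightarrow> 'c"
  assumes "finite C" "card C \<le> 3"
    and "\<And>c. x c \<in> C" "\<And>c. y c \<in> C"
    and neq: "\<And>c d. \<lbrakk>c \<in> {0..3}; d \<in> {0..3}; c \<noteq> d\<rbrakk> \<Longrightarrow> x c \<noteq> y d"
    and cd: "c \<in> {0..3}" "d \<in> {0..3}" "c \<noteq> d" "x c = y c"
  shows "x d \<noteq> y d"
proof
  assume eq: "x d = y d"
  have "card ({0..3} - {c, d}) = 2"
    using cd by (subst card_Diff_subset) auto
  then obtain e f where "{0..3} - {c, d} = {e, f}" and "e \<noteq> f"
    by (meson card_2_iff)
  then have ef: "e \<in> {0..3}" "f \<in> {0..3}" "e \<noteq> c" "e \<noteq> d" "f \<noteq> c" "f \<noteq> d"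
    by blast+
  show False
    by (rule no_four_distinct[of C "x c" "x d" "x e" "y f"])
      (use assms(1-4) cd eq ef \<open>e \<noteq> f\<close> neq[of c d] neq[of e c] neq[of e d] neq[of e f] neq[of c f] neq[of d f] in auto)
qed

text \<open>This is \<open>H\<close> pulled back to pairs of integers, so that connectedness and
  colorings are stated without a vertex set.\<close>

definition factor_adj :: "int \<Rightarrow> int \<times> int \<Rightarrow> int \<times> int \<Rightarrow> bool" where
  "factor_adj p = (\<lambda>(a, c) (a', c').
     (a - a') mod 4 = 2 \<and> \<not> p dvd c - c' \<or> odd (a - a') \<and> p dvd c - c')"

text \<open>Within a column \<open>c\<close>, the vertices \<open>a = 0, ..., 3\<close> form a
  4-cycle, so an opposite pair is monochromatic (\<open>mono\<close>). Since \<open>p > 3\<close>,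
  the columns 0 to 3 are distinct modulo \<open>p\<close>, and across them each opposite pair spans
  a crown graph, so it is monochromatic in at most one column (\<open>one\<close>). Three columns
  are too many for two pairs.\<close>

lemma factor_adj_not_3_colorable:
  fixes g :: "int \<times> int \<Rightarrow> 'c"
  assumes p: "p > 3" and C: "finite C" "card C \<le> 3" and g: "\<And>v. g v \<in> C"
  shows "\<exists>v w. factor_adj p v w \<and> g v = g w"
proof (rule ccontr)
  assume "\<nexists>v w. factor_adj p v w \<and> g v = g w"
  then have proper: "factor_adj p v w \<Longrightarrow> g v \<noteq> g w" for v w
    by blast
  have ndvd: "\<not> p dvd c - d" if "c \<in> {0..3}" "d \<in> {0..3}" "c \<noteq> d" for c d
    using that p zdvd_not_zless[of "c - d" p] zdvd_not_zless[of "d - c" p]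
    by (cases "c < d") (auto simp: dvd_diff_commute)
  have one: "g (a + 2, d) \<noteq> g (a, d)"
    if "c \<in> {0..3}" "d \<in> {0..3}" "c \<noteq> d" "g (a + 2, c) = g (a, c)" for a c d
    by (rule crown_at_most_one_monochromatic[of C "\<lambda>c. g (a + 2, c)" "\<lambda>c. g (a, c)" c])
      (use C g that ndvd in \<open>auto intro!: proper simp: factor_adj_def\<close>)
  have mono: "g (2, c) = g (0, c) \<or> g (3, c) = g (1, c)" for c
  proof (rule ccontr)
    assume "\<not> ?thesis"
    then show False
      by (intro no_four_distinct[of C "g (2, c)" "g (0, c)" "g (3, c)" "g (1, c)"])
        (use C g in \<open>auto intro!: proper simp: factor_adj_def\<close>)
  qed
  have xy: "g (2, d) \<noteq> g (0, d)" if "c \<in> {0..3}" "d \<in> {0..3}" "c \<noteq> d" "g (2, c) = g (0, c)" for c d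
    using one[of c d 0] that by simp
  have uv: "g (3, d) \<noteq> g (1, d)" if "c \<in> {0..3}" "d \<in> {0..3}" "c \<noteq> d" "g (3, c) = g (1, c)" for c d
    using one[of c d 1] that by simp
  show False
    using mono[of 0] mono[of 1] mono[of 2] xy[of 0 1] xy[of 0 2] xy[of 1 2]
      uv[of 0 1] uv[of 0 2] uv[of 1 2] by auto
qed

text \<open>Odd steps change \<open>a\<close> alone; a step by 2 in \<open>a\<close> can move
  \<open>c\<close> by one, and two odd steps then restore \<open>a\<close>.\<close>

lemma factor_adj_connected:
  assumes p: "p > 1"
  shows "(factor_adj p)\<^sup>*\<^sup>* v w"
proof -
  have h: "(factor_adj p)\<^sup>*\<^sup>* (a, c) (a + s, c)" if "odd s" for a c s
    using that by (intro r_into_rtranclp) (simp add: factor_adj_def)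
  have v: "(factor_adj p)\<^sup>*\<^sup>* (a, c) (a, c + s)" if "\<bar>s\<bar> = 1" for a c s
  proof -
    have "\<not> p dvd s"
      using that p by (metis abs_1 dvd_abs_iff zdvd1_eq abs_of_pos less_irrefl order_less_trans zero_less_one)
    then have "factor_adj p (a, c) (a + 2, c + s)"
      by (simp add: factor_adj_def)
    moreover have "(factor_adj p)\<^sup>*\<^sup>* (a + 2, c + s) (a, c + s)"
      using rtranclp_trans[OF h[of "- 1" "a + 2" "c + s"] h[of "- 1" "a + 2 + - 1" "c + s"]] by simp
    ultimately show ?thesis
      by (rule converse_rtranclp_into_rtranclp)
  qed
  have hh: "(factor_adj p)\<^sup>*\<^sup>* (a, c) (a', c)" for a a' c
  proof (induction a' rule: int_induct[of _ a])
    case (step1 i) then show ?case using h[of 1 i c] by (auto intro: rtranclp_trans)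
  next
    case (step2 i) then show ?case using h[of "- 1" i c] by (auto intro: rtranclp_trans)
  qed simp
  have vv: "(factor_adj p)\<^sup>*\<^sup>* (a, c) (a, c')" for a c c'
  proof (induction c' rule: int_induct[of _ c])
    case (step1 i) then show ?case using v[of 1 a i] by (auto intro: rtranclp_trans)
  next
    case (step2 i) then show ?case using v[of "- 1" a i] by (auto intro: rtranclp_trans)
  qed simp
  obtain a c a' c' where "v = (a, c)" "w = (a', c')"
    by (metis surj_pair)
  then show ?thesis
    using hh[of a c a'] vv[of a' c c'] by (auto intro: rtranclp_trans)
qed

section \<open>Adjacency as congruences modulo 3, 4 and \<open>p\<close>\<close>

text \<open>The condition modulo 3 is adjacency in \<open>K\<^sub>3\<close>, the rest is that of
  \<open>factor_adj\<close>. Forward, the gcd is tested by the divisors 2, 3, 4 and \<open>p\<close>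
  of \<open>12 * p\<close>; conversely, 2 or \<open>p\<close> is factored out and the cofactor is
  coprime to \<open>6 * p\<close> or 12.\<close>

lemma gcd_12_mult_prime_iff:
  fixes p :: nat and d :: int
  assumes p: "prime p" "p \<ge> 5"
  shows "nat (gcd d (int (12 * p))) \<in> {2, p} \<longleftrightarrow>
    \<not> 3 dvd d \<and> (d mod 4 = 2 \<and> \<not> int p dvd d \<or> odd d \<and> int p dvd d)"
    (is "?L \<longleftrightarrow> ?R")
proof
  have "prime (int p)"
    using p by simp
  have np: "\<not> 2 dvd int p" "\<not> 3 dvd int p"
    using p primes_dvd_imp_eq[of 2 "int p"] primes_dvd_imp_eq[of 3 "int p"] by auto
  have n2: "\<not> int p dvd 2"
    using p zdvd_not_zless[of 2 "int p"] by auto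
  {
    assume ?L
    then have cases: "gcd d (12 * int p) = 2 \<or> gcd d (12 * int p) = int p"
      using gcd_ge_0_int[of d "12 * int p"] by (auto simp del: gcd_ge_0_int)
    have dvd: "k dvd gcd d (12 * int p) \<longleftrightarrow> k dvd d" if "k dvd 12 * int p" for k
      using that by simp
    from cases show ?R
    proof
      assume eq: "gcd d (12 * int p) = 2"
      have "2 dvd d" "\<not> 3 dvd d" "\<not> 4 dvd d" "\<not> int p dvd d"
        using dvd[of 2] dvd[of 3] dvd[of 4] dvd[of "int p"] n2 eq by auto
      moreover from \<open>2 dvd d\<close> \<open>\<not> 4 dvd d\<close> have "d mod 4 = 2"
        by presburger
      ultimately show ?R
        by blast
    next
      assume eq: "gcd d (12 * int p) = int p"
      then show ?R
        using dvd[of 2] dvd[of 3] dvd[of "int p"] np by auto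
    qed
  }
  assume R: ?R
  have cop: "coprime e 3" if "\<not> 3 dvd e" for e :: int
    using that prime_imp_coprime[of 3 e] by (simp add: coprime_commute)
  from R consider "\<not> 3 dvd d" "d mod 4 = 2" "\<not> int p dvd d" | "\<not> 3 dvd d" "odd d" "int p dvd d"
    by blast
  then show ?L
  proof cases
    case 1
    define e where "e = d div 2"
    have e: "d = 2 * e" "odd e"
      using 1(2) unfolding e_def by presburger+
    have "coprime e 2" "coprime e 3" "coprime e (int p)"
      using 1 e cop[of e] prime_imp_coprime[OF \<open>prime (int p)\<close>, of e]
        dvd_mult[of 3 e 2] dvd_mult[of "int p" e 2]
      by (auto simp: coprime_commute)
    then have "coprime e (2 * 3 * int p)"
      by (simp only: coprime_mult_right_iff)
    then have "gcd e (2 * 3 * int p) = 1"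
      by (rule coprime_imp_gcd_eq_1)
    then have "gcd (2 * e) (2 * (2 * 3 * int p)) = 2"
      by (metis gcd_mult_distrib_int abs_numeral mult.right_neutral)
    then show ?thesis
      by (simp add: e(1))
  next
    case 2
    then obtain m where m: "d = int p * m"
      by blast
    have "coprime m 2" "coprime m 3"
      using 2 m cop[of m] dvd_mult[of 3 m "int p"] by auto
    then have "coprime m (2 * 2 * 3)"
      by (simp only: coprime_mult_right_iff)
    then have "gcd m 12 = 1"
      by (simp add: coprime_imp_gcd_eq_1)
    then have "gcd (int p * m) (int p * 12) = int p"
      by (metis gcd_mult_distrib_int abs_of_nat mult.right_neutral)
    then show ?thesis
      by (simp add: m mult.commute)
  qed
qed

lemma parcs_ICG_12_mult_prime_iff:
  assumes p: "prime p" "p \<ge> 5"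
  shows "(x, y) \<in> parcs (ICG (12 * p) {2, p}) \<longleftrightarrow> x \<in> {0..<12 * int p} \<and> y \<in> {0..<12 * int p} \<and>
    x mod 3 \<noteq> y mod 3 \<and>
    ((x - y) mod 4 = 2 \<and> \<not> int p dvd x - y \<or> odd (x - y) \<and> int p dvd x - y)"
  using gcd_12_mult_prime_iff[OF p, of "x - y"]
  by (auto simp: ICG_def mod_eq_dvd_iff)

text \<open>All moduli involved divide \<open>12 * p\<close>, so arbitrary integers can stand for
  vertices.\<close>

lemma mod_parcs_ICG_12_mult_prime:
  assumes p: "prime p" "p \<ge> 5"
    and "x mod 3 \<noteq> y mod 3"
    and "(x - y) mod 4 = 2 \<and> \<not> int p dvd x - y \<or> odd (x - y) \<and> int p dvd x - y"
  shows "(x mod (12 * int p), y mod (12 * int p)) \<in> parcs (ICG (12 * p) {2, p})"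
proof -
  define n where "n = 12 * int p"
  define q where "q = y div n - x div n"
  have q: "x mod n - y mod n = x - y + n * q"
    by (simp add: q_def algebra_simps flip: minus_mult_div_eq_mod)
  have "(x mod n) mod 3 = x mod 3" "(y mod n) mod 3 = y mod 3"
    by (auto simp: n_def intro!: mod_mod_cancel)
  moreover have "(x mod n - y mod n) mod 4 = (x - y) mod 4"
  proof -
    have "x mod n - y mod n = x - y + 4 * (3 * int p * q)"
      unfolding q by (simp add: n_def)
    then show ?thesis
      by (simp only: mod_mult_self2)
  qed
  moreover have "odd (x mod n - y mod n) \<longleftrightarrow> odd (x - y)"
    unfolding q by (simp add: n_def)
  moreover have "int p dvd x mod n - y mod n \<longleftrightarrow> int p dvd x - y"
    unfolding q by (rule dvd_add_left_iff) (simp add: n_def)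
  moreover have "x mod n \<in> {0..<n}" "y mod n \<in> {0..<n}"
    using p by (auto simp: n_def)
  ultimately show ?thesis
    using assms(3,4) unfolding parcs_ICG_12_mult_prime_iff[OF p] n_def[symmetric]
    by (simp only: simp_thms)
qed

section \<open>Uniqueness of the 3-coloring\<close>

text \<open>In coordinates \<open>(a, c)\<close> and \<open>b\<close>,
  \<open>tensor_complete_coloring\<close> shows that the class of a vertex depends on
  \<open>b\<close> alone and determines it. Every integer has such coordinates, and its residue
  modulo 3 is that of \<open>p * b\<close>.\<close>

lemma ICG_coloring_class_iff:
  assumes p: "prime p" "p \<ge> 5" and P: "proper_coloring (ICG (12 * p) {2, p}) k P" and k: "k \<le> 3"
    and V: "x \<in> {0..<12 * int p}" "y \<in> {0..<12 * int p}"
  shows "(\<exists>A\<in>P. x \<in> A \<and> y \<in> A) \<longleftrightarrow> x mod 3 = y mod 3"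
proof -
  define G where "G = ICG (12 * p) {2, p}"
  define n where "n = 12 * int p"
  have part: "partition_on {0..<n} P" and fin: "finite P" and card: "card P = k"
    and indep: "\<And>A u v. \<lbrakk>A \<in> P; u \<in> A; v \<in> A\<rbrakk> \<Longrightarrow> (u, v) \<notin> parcs G"
    using P by (auto simp: proper_coloring_def independent_set_def G_def n_def ICG_def)
  \<comment> \<open>The classes themselves serve as colors, and \<open>f'\<close> extends the
    coloring to all integers with period \<open>n\<close>.\<close>
  have "\<forall>u. \<exists>A\<in>P. u mod n \<in> A"
  proof
    fix u
    have "u mod n \<in> {0..<n}"
      using p by (simp add: n_def)
    then show "\<exists>A\<in>P. u mod n \<in> A"
      using partition_onD1[OF part] by blast
  qed
  then obtain f' where f': "\<And>u. f' u \<in> P" "\<And>u. u mod n \<in> f' u"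
    by metis
  have f'_eq: "f' u = A" if "A \<in> P" "u mod n \<in> A" for u A
    using partition_onD2[OF part] that f'[of u] by (auto simp: disjoint_def)
  have f'_mod: "f' u = f' v" if "u mod n = v mod n" for u v
    using f'_eq[OF f'(1), of u v] f'(2)[of v] that by simp
  \<comment> \<open>The coefficients are units modulo 4, 3, \<open>p\<close> and vanish modulo the other two moduli, so they
    separate the residues without requiring the idempotents of the Chinese remainder theorem.\<close>
  define F where "F = (\<lambda>(a, c) b. f' (3 * int p * a + 4 * int p * b + 12 * c))"
  have cop: "coprime 12 (int p)"
  proof -
    have "coprime (2 * 2 * 3) (int p)"
      using p primes_coprime[of 2 "int p"] primes_coprime[of 3 "int p"]
      by (simp only: coprime_mult_left_iff) auto
    then show ?thesis
      by simp
  qed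
  have n3: "\<not> 3 dvd int p" "odd p"
    using p primes_dvd_imp_eq[of 3 "int p"] prime_odd_nat[of p] by auto
  obtain \<psi> where \<psi>: "inj_on \<psi> {0..2}" "\<And>v b. b \<in> {0..2} \<Longrightarrow> F v b = \<psi> b"
  proof (rule tensor_complete_coloring[of P "{0..2::int}" F "factor_adj (int p)"])
    show "F v i \<in> P" for v i
      by (simp add: F_def f' split: prod.split)
    show "(factor_adj (int p))\<^sup>*\<^sup>* v w" for v w
      using p by (intro factor_adj_connected) simp
    show "\<exists>v w. factor_adj (int p) v w \<and> g v = g w" if "\<And>v. g v \<in> P" for g :: "int \<times> int \<Rightarrow> int set"
      using p fin card k that by (intro factor_adj_not_3_colorable[of _ P]) auto
    show "F v i \<noteq> F w j" if vw: "factor_adj (int p) v w" and ij: "i \<in> {0..2}" "j \<in> {0..2}" "i \<noteq> j"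
      for v w i j
    proof -
      obtain a c a' c' where ac: "v = (a, c)" "w = (a', c')"
        by (metis surj_pair)
      let ?u = "3 * int p * a + 4 * int p * i + 12 * c"
      let ?w = "3 * int p * a' + 4 * int p * j + 12 * c'"
      \<comment> \<open>The difference is regrouped for each modulus: the term in
        \<open>i - j\<close> survives modulo 3, that in \<open>c - c'\<close> modulo
        \<open>p\<close>, and that in \<open>a - a'\<close> modulo 2 and 4.\<close>
      have diff: "?u - ?w = 3 * int p * (a - a') + 4 * (int p * (i - j) + 3 * (c - c'))"
        by (simp add: algebra_simps)
      have "\<not> 3 dvd i - j"
        using ij zdvd_not_zless[of "i - j" 3] zdvd_not_zless[of "j - i" 3]
        by (cases "i < j") (auto simp: dvd_diff_commute)
      then have "\<not> 3 dvd 4 * (int p * (i - j))"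
        using n3 prime_dvd_mult_iff[of "3::int"] prime_dvd_mult_iff[of "3::int" 4] by auto
      moreover have "?u - ?w = 4 * (int p * (i - j)) + 3 * (int p * (a - a') + 4 * (c - c'))"
        by (simp add: algebra_simps)
      ultimately have m3: "?u mod 3 \<noteq> ?w mod 3"
        by (simp only: mod_eq_dvd_iff) (simp add: dvd_add_left_iff)
      have "?u - ?w = 12 * (c - c') + int p * (3 * (a - a') + 4 * (i - j))"
        by (simp add: algebra_simps)
      then have "int p dvd ?u - ?w \<longleftrightarrow> int p dvd 12 * (c - c')"
        by (simp only: dvd_add_left_iff[OF dvd_triv_left])
      also have "\<dots> \<longleftrightarrow> int p dvd c - c'"
        using cop by (intro coprime_dvd_mult_right_iff) (simp add: coprime_commute)
      finally have mp: "int p dvd ?u - ?w \<longleftrightarrow> int p dvd c - c'" .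
      have m2: "odd (?u - ?w) \<longleftrightarrow> odd (a - a')"
        using n3 unfolding diff by simp
      have m4: "(?u - ?w) mod 4 = 2" if four: "(a - a') mod 4 = 2"
      proof -
        obtain m where m: "a - a' = 4 * m + 2"
          using mult_div_mod_eq[of 4 "a - a'"] four by metis
        obtain q where q: "int p = 2 * q + 1"
          using n3 by (metis even_of_nat_iff oddE)
        have "?u - ?w = 2 + 4 * (3 * int p * m + 3 * q + 1 + (int p * (i - j) + 3 * (c - c')))"
          unfolding diff unfolding m q by (simp add: algebra_simps)
        then show ?thesis
          by (simp only: mod_mult_self2) simp
      qed
      have "(?u mod n, ?w mod n) \<in> parcs G"
        unfolding n_def G_def
        by (rule mod_parcs_ICG_12_mult_prime[OF p m3])
          (use vw ac mp m2 m4 in \<open>auto simp: factor_adj_def\<close>)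
      then have "f' ?u \<noteq> f' ?w"
        using indep[OF f'(1)[of ?u]] f'(2)[of ?u] f'(2)[of ?w] by metis
      then show ?thesis
        by (simp add: F_def ac)
    qed
  qed (use fin card k in auto)
  have repr: "\<exists>b\<in>{0..2}. z mod 3 = (int p * b) mod 3 \<and> f' z = \<psi> b" for z
  proof -
    obtain s t where st: "s * 12 + t * int p = 1"
      using bezout_int[of 12 "int p"] cop by auto
    define b where "b = (t * z) mod 3"
    define m where "m = (t * z) div 3"
    have tz: "t * z = 3 * m + b"
      by (simp add: b_def m_def)
    \<comment> \<open>Multiplying the Bezout identity by \<open>z\<close> and writing
      \<open>p\<close> as \<open>4 * p - 3 * p\<close> gives coordinates with \<open>t * z\<close>
      in place of \<open>b\<close>; reducing it to \<open>b\<close> costs only the multiple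
      \<open>n * m\<close>.\<close>
    define u where "u = - (t * z)"
    define v where "v = s * z"
    have "(s * 12 + t * int p) * z = z"
      using st by simp
    then have "z = 3 * int p * u + 4 * int p * (t * z) + 12 * v"
      by (simp add: u_def v_def algebra_simps)
    then have z: "z = 3 * int p * u + 4 * int p * b + 12 * v + n * m"
      unfolding tz by (simp add: n_def algebra_simps)
    have "f' z = F (u, v) b"
      unfolding F_def prod.case by (rule f'_mod) (simp only: z mod_mult_self2)
    moreover have "b \<in> {0..2}"
      using pos_mod_bound[of 3 "t * z"] by (simp add: b_def)
    moreover have "z mod 3 = (int p * b) mod 3"
    proof -
      have "z = int p * b + 3 * (int p * u + int p * b + 4 * v + 4 * int p * m)"
        unfolding z n_def by (simp add: algebra_simps)
      then show ?thesis
        by (simp only: mod_mult_self2)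
    qed
    ultimately show ?thesis
      using \<psi>(2) by auto
  qed
  obtain b b' where b: "b \<in> {0..2}" "x mod 3 = (int p * b) mod 3" "f' x = \<psi> b"
    and b': "b' \<in> {0..2}" "y mod 3 = (int p * b') mod 3" "f' y = \<psi> b'"
    using repr by blast
  \<comment> \<open>Since \<open>p\<close> is a unit modulo 3, the residue of \<open>p * b\<close>
    determines \<open>b\<close>; injectivity of \<open>\<psi>\<close> then passes to
    classes.\<close>
  have "x mod 3 = y mod 3 \<longleftrightarrow> 3 dvd int p * (b - b')"
    by (simp add: b b' mod_eq_dvd_iff right_diff_distrib)
  also have "\<dots> \<longleftrightarrow> 3 dvd b - b'"
    using n3 prime_dvd_mult_iff[of "3::int"] by auto
  also have "\<dots> \<longleftrightarrow> b = b'"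
    using b(1) b'(1) by auto presburger
  also have "\<dots> \<longleftrightarrow> f' x = f' y"
    using b b' \<psi>(1) by (auto simp: inj_on_def)
  also have "\<dots> \<longleftrightarrow> (\<exists>A\<in>P. x \<in> A \<and> y \<in> A)"
  proof -
    have "x mod n = x" "y mod n = y"
      using V by (simp_all add: n_def)
    then show ?thesis
      using f'(1)[of x] f'(2)[of x] f'(2)[of y] f'_eq[of _ x] f'_eq[of _ y] by metis
  qed
  finally show ?thesis
    by simp
qed

text \<open>A partition is determined by its equivalence relation. The right-hand side involves
  neither \<open>P\<close> nor \<open>k\<close>, so this yields both uniqueness and the lower bound
  on the chromatic number.\<close>

lemma ICG_coloring_eq_quotient:
  assumes p: "prime p" "p \<ge> 5" and P: "proper_coloring (ICG (12 * p) {2, p}) k P" and k: "k \<le> 3"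
  shows "P = {0..<12 * int p} // {(x, y). x \<in> {0..<12 * int p} \<and> y \<in> {0..<12 * int p} \<and> x mod 3 = y mod 3}"
    (is "_ = ?V // ?R")
proof -
  have part: "partition_on ?V P"
    using P by (simp add: proper_coloring_def ICG_def)
  have "{(x, y). \<exists>A\<in>P. x \<in> A \<and> y \<in> A} = ?R"
    using ICG_coloring_class_iff[OF assms] partition_onD1[OF part] by blast
  then show ?thesis
    using partition_on_eq_quotient[OF part] by simp
qed

text \<open>Arcs join different residues modulo 3, and each \<open>r\<close> in
  \<open>{0..2}\<close> lies in its own class, so the classes are nonempty and distinct.\<close>

lemma ICG_residue_coloring:
  assumes p: "prime p" "p \<ge> 5"
  shows "proper_coloring (ICG (12 * p) {2, p}) 3
    ((\<lambda>r. {x \<in> {0..<12 * int p}. x mod 3 = r}) ` {0..2})"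
    (is "proper_coloring ?G _ (?A ` _)")
proof -
  have "r \<in> ?A r" if "r \<in> {0..2}" for r
    using that p by auto
  then have ne: "?A r \<noteq> {}" if "r \<in> {0..2}" for r
    using that by blast
  have "inj_on ?A {0..2}"
  proof (rule inj_onI)
    fix r s :: int
    assume "r \<in> {0..2}" "?A r = ?A s"
    with \<open>r \<in> {0..2} \<Longrightarrow> r \<in> ?A r\<close> have "r \<in> ?A s"
      by blast
    with \<open>r \<in> {0..2}\<close> show "r = s"
      by auto
  qed
  then have "card (?A ` {0..2}) = 3"
    by (simp add: card_image)
  moreover have "\<Union> (?A ` {0..2}) = {0..<12 * int p}"
  proof -
    have "x mod 3 \<in> {0..2}" for x :: int
      using pos_mod_bound[of 3 x] by simp
    then show ?thesis
      by blast
  qed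
  moreover have "disjoint (?A ` {0..2})"
    by (auto simp: disjoint_def)
  moreover have "{} \<notin> ?A ` {0..2}"
  proof
    assume "{} \<in> ?A ` {0..2}"
    then obtain r where r: "{} = ?A r" "r \<in> {0..2}"
      by (rule imageE)
    show False
      using ne[OF r(2)] r(1)[symmetric] by (rule notE)
  qed
  moreover have "independent_set ?G (?A r)" for r
    using parcs_ICG_12_mult_prime_iff[OF p] by (auto simp: independent_set_def ICG_def)
  then have "\<forall>B \<in> ?A ` {0..2}. independent_set ?G B"
    by blast
  moreover have "pverts ?G = {0..<12 * int p}"
    by (simp add: ICG_def)
  ultimately show ?thesis
    by (simp only: proper_coloring_def partition_on_def finite_imageI finite_atLeastAtMost_int simp_thms)
qed

lemma ICG_uniquely_3_colorable:
  assumes p: "prime p" "p \<ge> 5"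
  shows "uniquely_k_colorable 3 (ICG (12 * p) {2, p})"
proof -
  let ?G = "ICG (12 * p) {2, p}"
  obtain Q where Q: "proper_coloring ?G 3 Q"
    using ICG_residue_coloring[OF p] by blast
  \<comment> \<open>With \<open>k\<close> free, a coloring with fewer classes would also equal
    \<open>Q\<close>, contradicting \<open>card Q = 3\<close>.\<close>
  have eq: "P = Q" if "proper_coloring ?G k P" "k \<le> 3" for k P
    using ICG_coloring_eq_quotient[OF p that] ICG_coloring_eq_quotient[OF p Q] by simp
  have "chromatic_number ?G = 3"
    unfolding chromatic_number_def
  proof (rule Least_equality)
    show "\<exists>P. proper_coloring ?G 3 P"
      using Q by blast
    show "3 \<le> k" if "\<exists>P. proper_coloring ?G k P" for k
      using that eq[of k] Q by (cases "k \<le> 3") (auto simp: proper_coloring_def)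
  qed
  then show ?thesis
    using Q eq by (auto simp: uniquely_k_colorable_def uniquely_colorable_def)
qed

section \<open>Circulant structure and clique number\<close>

text \<open>The connection set \<open>S\<close> is closed under negation because the gcd with
  \<open>n\<close> is unchanged by negation and by reduction modulo \<open>n\<close>.\<close>

lemma circulant_ICG:
  assumes "n \<ge> 1"
  shows "circulant (ICG n D)"
proof -
  define S where "S = {s \<in> {0..<int n} - {0}. nat (gcd s (int n)) \<in> D}"
  have neg: "(- s) mod int n \<in> S" if "s \<in> S" for s
  proof -
    have "(- s) mod int n \<noteq> 0"
      using that zdvd_not_zless[of s "int n"] by (auto simp: S_def mod_eq_0_iff_dvd)
    moreover have "gcd ((- s) mod int n) (int n) = gcd s (int n)"
      by (simp add: gcd.commute flip: gcd_red_int)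
    ultimately show ?thesis
      using that assms by (auto simp: S_def)
  qed
  have "S = (\<lambda>s. (- s) mod int n) ` S"
  proof (intro equalityI subsetI)
    fix s assume s: "s \<in> S"
    then have "s = (- ((- s) mod int n)) mod int n"
      by (simp add: mod_minus_eq S_def)
    then show "s \<in> (\<lambda>s. (- s) mod int n) ` S"
      using neg[OF s] by blast
  qed (use neg in auto)
  moreover have "ICG n D = cayley_graph_mod n S"
  proof -
    have "a \<noteq> b \<and> nat (gcd (a - b) (int n)) \<in> D \<longleftrightarrow> (a - b) mod int n \<in> S"
      if "a \<in> {0..<int n}" "b \<in> {0..<int n}" for a b
    proof -
      have "(a - b) mod int n = 0 \<longleftrightarrow> a = b"
        using that by (simp flip: mod_eq_dvd_iff add: mod_eq_0_iff_dvd)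
      moreover have "gcd ((a - b) mod int n) (int n) = gcd (a - b) (int n)"
        by (simp add: gcd.commute flip: gcd_red_int)
      ultimately show ?thesis
        using assms by (auto simp: S_def)
    qed
    then show ?thesis
      by (auto simp: ICG_def cayley_graph_mod_def)
  qed
  moreover have "S \<subseteq> {0..<int n} - {0}"
    by (auto simp: S_def)
  ultimately show ?thesis
    using assms unfolding circulant_def by blast
qed

text \<open>By parity, none or exactly two of the three differences are odd. If none is, all are 2
  modulo 4, against additivity. If two are, \<open>p\<close> divides both and hence the third, which
  is even and so not divisible by \<open>p\<close>.\<close>

lemma ICG_triangle_free:
  assumes p: "prime p" "p \<ge> 5"
    and xy: "(x, y) \<in> parcs (ICG (12 * p) {2, p})"
    and yz: "(y, z) \<in> parcs (ICG (12 * p) {2, p})"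
    and xz: "(x, z) \<in> parcs (ICG (12 * p) {2, p})"
  shows False
proof -
  note arc = xy[unfolded parcs_ICG_12_mult_prime_iff[OF p]]
    yz[unfolded parcs_ICG_12_mult_prime_iff[OF p]] xz[unfolded parcs_ICG_12_mult_prime_iff[OF p]]
  have sum: "x - z = (x - y) + (y - z)"
    by simp
  have "int p dvd x - y \<Longrightarrow> int p dvd y - z \<Longrightarrow> int p dvd x - z"
    "int p dvd x - y \<Longrightarrow> int p dvd x - z \<Longrightarrow> int p dvd y - z"
    "int p dvd y - z \<Longrightarrow> int p dvd x - z \<Longrightarrow> int p dvd x - y"
    unfolding sum using dvd_add_right_iff dvd_add_left_iff by blast+
  moreover have "\<not> ((x - y) mod 4 = 2 \<and> (y - z) mod 4 = 2 \<and> (x - z) mod 4 = 2)"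
    by presburger
  moreover have "odd (x - y) \<Longrightarrow> odd (y - z) \<Longrightarrow> even (x - z)"
    "odd (x - y) \<Longrightarrow> even (y - z) \<Longrightarrow> odd (x - z)"
    "even (x - y) \<Longrightarrow> odd (y - z) \<Longrightarrow> odd (x - z)"
    "even (x - y) \<Longrightarrow> even (y - z) \<Longrightarrow> even (x - z)"
    by presburger+
  moreover have "even d" if "d mod 4 = 2" for d :: int
    using that by presburger
  ultimately show False
    using arc by metis
qed

lemma clique_number_ICG:
  assumes p: "prime p" "p \<ge> 5"
  shows "clique_number (ICG (12 * p) {2, p}) = 2"
  unfolding clique_number_def
proof (rule Max_eqI)
  let ?G = "ICG (12 * p) {2, p}"
  have le: "card A \<le> 2" if "clique ?G A" for A
  proof (rule ccontr)
    assume "\<not> card A \<le> 2"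
    then have "3 \<le> card A"
      by simp
    then obtain B where "B \<subseteq> A" "card B = 3"
      by (meson obtain_subset_with_card_n)
    then obtain x y z where "{x, y, z} \<subseteq> A" "x \<noteq> y" "y \<noteq> z" "x \<noteq> z"
      by (auto simp: card_3_iff)
    then show False
      using that ICG_triangle_free[OF p, of x y z] by (auto simp: clique_def)
  qed
  show "k \<le> 2" if "k \<in> {card A |A. clique ?G A}" for k
    using that le by blast
  show "finite {card A |A. clique ?G A}"
    by (rule finite_subset[of _ "{..2}"]) (use le in auto)
  \<comment> \<open>The clique of size 2 is the edge between 0 and 2; the bound
    \<open>p \<ge> 5\<close> keeps 2 from being a multiple of \<open>p\<close>.\<close>
  have "\<not> int p dvd 2"
    using p zdvd_not_zless[of 2 "int p"] by auto
  then have "clique ?G {0, 2}"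
    using p parcs_ICG_12_mult_prime_iff[OF p] by (auto simp: clique_def ICG_def)
  moreover have "card {0, 2 :: int} = 2"
    by simp
  ultimately show "2 \<in> {card A |A. clique ?G A}"
    by (metis (mono_tags, lifting) mem_Collect_eq)
qed

section \<open>The infinite family up to isomorphism\<close>

lemma digraph_iso_card_verts:
  assumes "digraph_iso G H"
  shows "card (verts G) = card (verts H)"
proof -
  obtain hom where "pre_digraph.digraph_isomorphism G hom" "H = app_iso hom G"
    using assms by (auto simp: digraph_iso_def)
  then show ?thesis
    by (simp add: pre_digraph.digraph_isomorphism_def card_image)
qed

text \<open>Different orders make the family infinite up to isomorphism, not merely as a set of
  labelled graphs.\<close>

lemma not_digraph_iso_ICG:
  assumes "m \<noteq> n"
  shows "\<not> digraph_iso (with_proj (ICG m D)) (with_proj (ICG n D'))"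
  using digraph_iso_card_verts[of "with_proj (ICG m D)" "with_proj (ICG n D')"] assms
  by (auto simp: ICG_def)

theorem theorem3p1:
  shows "(\<forall>p::nat. prime p \<and> p \<ge> 5 \<longrightarrow>
            circulant (ICG (12 * p) {2, p}) \<and>
            uniquely_k_colorable 3 (ICG (12 * p) {2, p}) \<and>
            clique_number (ICG (12 * p) {2, p}) = 2) \<and>
         (\<exists>F :: int pair_pre_digraph set.
            infinite F \<and>
            pairwise (\<lambda>G H. \<not> digraph_iso (with_proj G) (with_proj H)) F \<and>
            (\<forall>G\<in>F. circulant G \<and> uniquely_colorable G \<and>
                   chromatic_number G \<noteq> clique_number G)) \<and>
         \<not> (\<forall>G. circulant G \<and> uniquely_colorable G \<longrightarrow>
                chromatic_number G = clique_number G)"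
proof -
  let ?G = "\<lambda>p. ICG (12 * p) {2, p}"
  define F where "F = ?G ` {p. prime p \<and> p \<ge> 5}"
  have G: "circulant (?G p) \<and> uniquely_k_colorable 3 (?G p) \<and> clique_number (?G p) = 2"
    if "prime p" "p \<ge> 5" for p
    using that by (simp add: circulant_ICG ICG_uniquely_3_colorable clique_number_ICG)
  have "inj ?G"
    by (rule injI) (auto simp: ICG_def dest!: arg_cong[of _ _ "\<lambda>A :: int set. card A"])
  moreover have "infinite {p::nat. prime p \<and> p \<ge> 5}"
  proof
    assume "finite {p::nat. prime p \<and> p \<ge> 5}"
    then have "finite ({p::nat. prime p \<and> p \<ge> 5} \<union> {..5})"
      by simp
    moreover have "{p::nat. prime p} \<subseteq> {p. prime p \<and> p \<ge> 5} \<union> {..5}"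
      by auto
    ultimately show False
      using primes_infinite finite_subset by blast
  qed
  ultimately have inf: "infinite F"
    unfolding F_def by (meson finite_imageD inj_on_subset subset_UNIV)
  have F: "circulant G \<and> uniquely_colorable G \<and> chromatic_number G \<noteq> clique_number G"
    if "G \<in> F" for G
    using that G by (force simp: F_def uniquely_k_colorable_def)
  have "pairwise (\<lambda>G H. \<not> digraph_iso (with_proj G) (with_proj H)) F"
  proof (rule pairwiseI)
    fix G H assume "G \<in> F" "H \<in> F" "G \<noteq> H"
    then obtain p q where "G = ?G p" "H = ?G q" "12 * p \<noteq> 12 * q"
      unfolding F_def by auto
    then show "\<not> digraph_iso (with_proj G) (with_proj H)"
      using not_digraph_iso_ICG by blast
  qed
  moreover have "\<exists>G. G \<in> F"
    using inf infinite_imp_nonempty by blast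
  ultimately show ?thesis
    using G F inf by blast
qed

end
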